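(* Let $B$ be a finite skew left brace, let $p$ be the smallest prime which divides $|B|$, and let $d=|B/\mathrm{Ann}(B)|$. Then the following hold. (1) If $|B/\mathrm{Ann}(B)|=p$, then $\mathrm{Pb}(B)=\frac{2p-1}{p^2}$. (2) $\mathrm{Pb}(B)\leqslant\frac{p+d-1}{pd}\leqslant\frac{2p-1}{p^2}$. Furthermore, if $\mathrm{Ann}(B)\subsetneq \mathrm{Cb}_B(x)$ for all $x\in B$, then $\mathrm{Pb}(B)\geqslant\frac{pd+d-p}{d^2}$. (3) If $B/\mathrm{Ann}(B)$ is of non-prime power order and $q$ is the second smallest prime divisor of $|B|$, then $$\mathrm{Pb}(B)\leqslant\frac{1}{p}+\frac{|\mathrm{Ann}(B)|(p-1)-1}{p|B|}+\frac{1}{s|B|},$$ where $s$ is either $q$ or $p^2$. (4) In particular, if $|B|=p^n$, then either $\mathrm{Pb}(B)=1$, $\mathrm{Pb}(B)=\frac{2p-1}{p^2}$, or $\mathrm{Pb}(B)\leqslant\frac{p^2+p-1}{p^3}$. (5) If $|B|=p^n$, $|\mathrm{Ann}(B)|=1$ and $(B,\circ)$ is not an elementary abelian group, then $\mathrm{Pb}(B)\leqslant\frac{1}{p}+\frac{(p-1)^2}{p^{n+2}}$.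
   Context: A skew left brace is a set $B$ with two group structures $(B,+)$ and $(B,\circ)$ (neither assumed abelian) such that $a\circ(b+c)=(a\circ b)-a+(a\circ c)$ for all $a,b,c\in B$, where $-a$ is the inverse of $a$ in $(B,+)$. The identities of the two groups coincide and are denoted by $1$. Put $a*b:=-a+(a\circ b)-b$ and $[a,b]^+:=a+b-a-b$. The annihilator of $B$ is $\mathrm{Ann}(B):=\{a\in B\mid a+b=b+a=a\circ b=b\circ a \text{ for all } b\in B\}$; it is an ideal of $B$, so $B/\mathrm{Ann}(B)$ is a quotient skew brace. The brace centralizer of $x\in B$ is $\mathrm{Cb}_B(x):=\{b\in B\mid x*b=b*x=[x,b]^+=1\}$. For a finite skew left brace $B$, the commuting probability is $$\mathrm{Pb}(B):=\frac{1}{|B|^2}\,\bigl|\{(a,b)\in B\times B \mid a*b=b*a=[a,b]^+=1\}\bigr|.$$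
   Formalization: In (2), the inequality (p+d-1)/(pd) ≤ (2p-1)/p² is stated only for Ann(B) ≠ B, since for d=1 it reads 1 ≤ (2p-1)/p², which is false; in (3), a quotient of order 1 counts as being of prime power order. *)

theory Defs
  imports Complex_Main "HOL-Computational_Algebra.Primes" "HOL-Algebra.QuotRing"
begin

text \<open>
  A skew left brace is carried by the record type of HOL-Algebra rings: addition of the record is
  the group operation written \<open>+\<close>, multiplication is the one written \<open>\<circ>\<close>. Neither is assumed
  commutative and only the brace law below relates them; it forces the zero and the one of the
  record to coincide.
\<close>

locale skew_left_brace =
  fixes B (structure)
  assumes additive_group: "group (add_monoid B)"
    and circle_group: "group B"
    and brace_law: "\<lbrakk>a \<in> carrier B; b \<in> carrier B; c \<in> carrier B\<rbrakk>
      \<Longrightarrow> a \<otimes> (b \<oplus> c) = ((a \<otimes> b) \<ominus> a) \<oplus> (a \<otimes> c)"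

definition brace_star :: "('a, 'm) ring_scheme \<Rightarrow> 'a \<Rightarrow> 'a \<Rightarrow> 'a" where
  "brace_star B a b = (\<ominus>\<^bsub>B\<^esub> a \<oplus>\<^bsub>B\<^esub> (a \<otimes>\<^bsub>B\<^esub> b)) \<ominus>\<^bsub>B\<^esub> b"

definition add_commutator :: "('a, 'm) ring_scheme \<Rightarrow> 'a \<Rightarrow> 'a \<Rightarrow> 'a" where
  "add_commutator B a b = ((a \<oplus>\<^bsub>B\<^esub> b) \<ominus>\<^bsub>B\<^esub> a) \<ominus>\<^bsub>B\<^esub> b"

definition brace_commute :: "('a, 'm) ring_scheme \<Rightarrow> 'a \<Rightarrow> 'a \<Rightarrow> bool" where
  "brace_commute B a b \<longleftrightarrow>
     brace_star B a b = \<one>\<^bsub>B\<^esub> \<and> brace_star B b a = \<one>\<^bsub>B\<^esub> \<and> add_commutator B a b = \<one>\<^bsub>B\<^esub>"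

definition Ann :: "('a, 'm) ring_scheme \<Rightarrow> 'a set" where
  "Ann B = {a \<in> carrier B. \<forall>b \<in> carrier B.
     a \<oplus>\<^bsub>B\<^esub> b = b \<oplus>\<^bsub>B\<^esub> a \<and> b \<oplus>\<^bsub>B\<^esub> a = a \<otimes>\<^bsub>B\<^esub> b \<and> a \<otimes>\<^bsub>B\<^esub> b = b \<otimes>\<^bsub>B\<^esub> a}"

definition Cb :: "('a, 'm) ring_scheme \<Rightarrow> 'a \<Rightarrow> 'a set" where
  "Cb B x = {b \<in> carrier B. brace_commute B x b}"

definition Pb :: "('a, 'm) ring_scheme \<Rightarrow> real" where
  "Pb B = real (card {(a, b) \<in> carrier B \<times> carrier B. brace_commute B a b}) / (real (order B))\<^sup>2"

text \<open>
  The library construction \<open>B Quot I\<close> applies to any ring-like record: its elements are the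
  additive cosets of \<open>I\<close>, with both operations induced from \<open>B\<close>. For an ideal of a skew left
  brace the additive and the circle cosets agree, and this is the quotient skew brace.
\<close>

abbreviation Ann_quotient :: "('a, 'm) ring_scheme \<Rightarrow> 'a set ring" where
  "Ann_quotient B \<equiv> B Quot Ann B"

definition elementary_abelian :: "('a, 'm) monoid_scheme \<Rightarrow> bool" where
  "elementary_abelian G \<longleftrightarrow>
     comm_group G \<and> (\<exists>r::nat. prime r \<and> (\<forall>x \<in> carrier G. x [^]\<^bsub>G\<^esub> r = \<one>\<^bsub>G\<^esub>))"

definition smallest_prime_divisor :: "nat \<Rightarrow> nat \<Rightarrow> bool" where
  "smallest_prime_divisor p n \<longleftrightarrow>
     prime p \<and> p dvd n \<and> (\<forall>r. prime r \<and> r dvd n \<longrightarrow> p \<le> r)"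

definition second_smallest_prime_divisor :: "nat \<Rightarrow> nat \<Rightarrow> bool" where
  "second_smallest_prime_divisor q n \<longleftrightarrow>
     (\<exists>p. smallest_prime_divisor p n \<and> prime q \<and> q dvd n \<and> q \<noteq> p \<and>
       (\<forall>r. prime r \<and> r dvd n \<and> r \<noteq> p \<longrightarrow> q \<le> r))"

text \<open>
  The exponent 0 is allowed: the trivial group counts as a group of prime power order.
  (The library predicate \<open>primepow\<close> excludes 1.)
\<close>

definition prime_power_order :: "('a, 'm) monoid_scheme \<Rightarrow> bool" where
  "prime_power_order G \<longleftrightarrow> (\<exists>r k::nat. prime r \<and> order G = r ^ k)"

end

theory Submission
  imports Defs "HOL-Algebra.Sylow" "HOL-Algebra.Multiplicative_Group"
begin

text \<open>
  The commuting probability is \<open>|B|\<^sup>-\<^sup>2\<close> times the sum of the sizes of all brace centralizers. Two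
  facts reduce everything to group theory: each centralizer is a subgroup of the circle group
  (\<open>subgroup_Cb\<close>), and the elements whose centralizer is everything form the annihilator
  (\<open>center_eq_Ann\<close>). From then on only a symmetric relation on a finite group with subgroups as
  centralizers is needed; this is the locale \<open>centralizer_relation\<close>, with \<open>z\<close> central elements in
  a group of order \<open>n\<close>.

  A central element contributes \<open>n\<close> to the sum and any other element at most \<open>n / p\<close>, because the
  index of a proper subgroup is at least the smallest prime \<open>p\<close> dividing \<open>n\<close>. This is the general
  upper bound. If the central quotient has order \<open>p\<close>, no subgroup lies strictly between the
  centre and the group, so every noncentral centralizer is the centre and the value is exact. If
  every centralizer is strictly larger than the centre, each contributes at least \<open>p z\<close>, which is
  the lower bound.

  The sharper bounds come from noncentral elements whose centralizer has index larger than \<open>p\<close>: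
  each lowers the sum by its gap to \<open>n / p\<close> (\<open>commuting_probability_le\<close>). A subgroup \<open>H\<close> of index
  \<open>p\<close> is normal with quotient of order \<open>p\<close>, so it contains all \<open>p\<close>-th powers and all commutators,
  and such elements are forced as follows.

  \<^item> In a \<open>p\<close>-group with trivial centre, if all noncentral elements had index \<open>p\<close>, all commutators
    and \<open>p\<close>-th powers would be central, hence trivial, and the group elementary abelian. So one
    element has index at least \<open>p\<^sup>2\<close>, and its gap gives the claimed bound.

  \<^item> If a prime \<open>r \<noteq> p\<close> divides the order of the central quotient, a Sylow \<open>r\<close>-subgroup contains a
    noncentral \<open>b\<close>. Its order is prime to \<open>p\<close>, so \<open>b\<close> lies in every subgroup of index \<open>p\<close>. By
    symmetry all \<open>x\<close> outside the centralizer of \<open>b\<close> have index at least \<open>p + 1\<close>. These are at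
    least \<open>n - n / p\<close> elements, and together they save at least \<open>n / p\<close>. This gives the
    bound \<open>1 / p + (z (p - 1) - 1) / (p n)\<close>, and \<open>1 / (s n)\<close> is nonnegative.
\<close>

section \<open>Subgroups of smallest prime index\<close>

lemma (in group) subgroup_pow_closed:
  assumes "subgroup H G" "h \<in> H"
  shows "h [^] (n::nat) \<in> H"
  using assms by (induction n) (auto simp: subgroup.one_closed subgroup.m_closed)

lemma (in group) mem_subgroup_if_coprime_pows:
  assumes H: "subgroup H G" and b: "b \<in> carrier G"
    and m: "b [^] (m::nat) \<in> H" and n: "b [^] (n::nat) \<in> H" and "coprime m n"
  shows "b \<in> H"
proof (cases "m = 0")
  case True
  with assms show ?thesis by simp
next
  case False
  then obtain u v where "m * u = n * v + gcd m n"
    using bezout_nat by blast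
  then have uv: "m * u = n * v + 1" using \<open>coprime m n\<close> by simp
  have "b [^] (m * u) = b [^] (n * v) \<otimes> b"
    unfolding uv using b by simp
  moreover have "b [^] (m * u) \<in> H" "b [^] (n * v) \<in> H"
    using subgroup_pow_closed[OF H m, of u] subgroup_pow_closed[OF H n, of v] b
    by (simp_all add: nat_pow_pow)
  moreover have "b = inv (b [^] (n * v)) \<otimes> (b [^] (n * v) \<otimes> b)"
    using b by (simp add: m_assoc[symmetric])
  ultimately show ?thesis
    using H by (metis subgroup.m_closed subgroup.m_inv_closed)
qed

lemma (in group) subgroup_card_dvd:
  assumes "subgroup H G" "subgroup K G" "H \<subseteq> K"
  shows "card H dvd card K"
proof -
  interpret K: group "G\<lparr>carrier := K\<rparr>"
    using assms(2) group_axioms by (rule subgroup.subgroup_is_group)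
  have "card (rcosets\<^bsub>G\<lparr>carrier := K\<rparr>\<^esub> H) * card H = card K"
    using K.lagrange[OF subgroup_incl[OF assms]] by (simp add: order_def)
  then show ?thesis by (metis dvd_triv_right)
qed

lemma coprime_below_smallest_prime_divisor:
  assumes p: "smallest_prime_divisor p n" and i: "0 < i" "i < p"
  shows "coprime i n"
proof (rule ccontr)
  assume "\<not> coprime i n"
  then obtain r where "prime r" "r dvd gcd i n"
    using prime_factor_nat[of "gcd i n"] by (auto simp: coprime_iff_gcd_eq_1)
  then have "p \<le> r" "r \<le> i"
    using p i dvd_imp_le by (auto simp: smallest_prime_divisor_def)
  with i show False by simp
qed

lemma smallest_prime_divisor_le:
  assumes p: "smallest_prime_divisor p n" and "m dvd n" "m \<noteq> 1" "m \<noteq> 0"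
  shows "p \<le> m"
proof -
  obtain r where r: "prime r" "r dvd m" using prime_factor_nat \<open>m \<noteq> 1\<close> by blast
  then have "p \<le> r" using p \<open>m dvd n\<close> dvd_trans by (auto simp: smallest_prime_divisor_def)
  with dvd_imp_le[OF r(2)] \<open>m \<noteq> 0\<close> show ?thesis by simp
qed

text \<open>
  Exponents \<open>0 < i < p\<close> are coprime to the group order, so \<open>x [^] i \<in> H\<close> would force \<open>x \<in> H\<close>.
  Hence the \<open>p\<close> cosets of the powers of \<open>x\<close> are distinct, and they are all the cosets there are.
\<close>
lemma (in group) cosets_of_powers:
  assumes fin: "finite (carrier G)" and p: "smallest_prime_divisor p (order G)"
    and H: "subgroup H G" and index: "p * card H = order G"
    and x: "x \<in> carrier G" "x \<notin> H" and y: "y \<in> carrier G"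
  obtains h i where "h \<in> H" "i < p" "y = h \<otimes> x [^] (i::nat)"
proof -
  have not_mem: "x [^] i \<notin> H" if "0 < i" "i < p" for i :: nat
  proof
    assume "x [^] i \<in> H"
    moreover have "x [^] order G \<in> H"
      using x H by (simp add: pow_order_eq_1 subgroup.one_closed)
    ultimately have "x \<in> H"
      by (rule mem_subgroup_if_coprime_pows[OF H x(1)])
        (rule coprime_below_smallest_prime_divisor[OF p that])
    with x(2) show False ..
  qed
  have neq: "H #> x [^] i \<noteq> H #> x [^] j" if "i < j" "j < p" for i j :: nat
  proof
    assume "H #> x [^] i = H #> x [^] j"
    then have "x [^] j \<in> H #> x [^] i"
      using rcos_self[OF _ H, of "x [^] j"] x by simp
    then have "x [^] j \<otimes> inv (x [^] i) \<in> H"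
      using subgroup.rcos_module[OF H group_axioms] x by simp
    moreover have "x [^] j = x [^] (j - i) \<otimes> x [^] i"
      using that x by (simp add: nat_pow_mult)
    ultimately have "x [^] (j - i) \<in> H"
      using x by (simp add: m_assoc)
    with not_mem that show False by auto
  qed
  define C where "C = (\<lambda>i. H #> x [^] i) ` {..<p}"
  have "inj_on (\<lambda>i. H #> x [^] i) {..<p}"
    using neq by (auto simp: inj_on_def) (metis nat_neq_iff)
  then have "card C = p" by (simp add: C_def card_image)
  have "card H > 0"
    by (rule subgroup.finite_imp_card_positive[OF H fin])
  then have "card (rcosets H) = p"
    using lagrange[OF H] index by (metis mult_right_cancel not_gr_zero)
  moreover have "C \<subseteq> rcosets H"
    using x subgroup.subset[OF H] by (auto simp: C_def intro: rcosetsI)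
  moreover have "finite (rcosets H)"
    using fin by (auto simp: RCOSETS_def)
  ultimately have "C = rcosets H"
    using \<open>card C = p\<close> by (metis card_subset_eq)
  moreover have "y \<in> H #> y" using rcos_self[OF y H] .
  moreover have "H #> y \<in> rcosets H" using y subgroup.subset[OF H] by (auto intro: rcosetsI)
  ultimately obtain i where "i < p" "y \<in> H #> x [^] i" unfolding C_def by auto
  then show thesis using that by (auto simp: r_coset_def)
qed

text \<open>
  The coset of \<open>x [^] p\<close> is that of some \<open>x [^] i\<close> with \<open>i < p\<close>, so \<open>x [^] (p - i) \<in> H\<close>. For
  \<open>i \<noteq> 0\<close> this exponent is coprime to the group order, which puts \<open>x\<close> itself into \<open>H\<close>.
\<close>
lemma (in group) pow_mem_of_smallest_prime_index:
  assumes fin: "finite (carrier G)" and p: "smallest_prime_divisor p (order G)"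
    and H: "subgroup H G" and index: "p * card H = order G"
    and x: "x \<in> carrier G"
  shows "x [^] p \<in> H"
proof (cases "x \<in> H")
  case True
  then show ?thesis by (rule subgroup_pow_closed[OF H])
next
  case False
  obtain h i where hi: "h \<in> H" "i < p" "x [^] p = h \<otimes> x [^] (i::nat)"
    using cosets_of_powers[OF fin p H index x False, of "x [^] p"] x by blast
  have h: "h \<in> carrier G" using H hi(1) by (rule subgroup.mem_carrier)
  have "x [^] p = x [^] (p - i) \<otimes> x [^] i"
    using hi(2) x by (simp add: nat_pow_mult)
  then have "x [^] (p - i) = h"
    using hi(3) h x by simp
  show ?thesis
  proof (cases "i = 0")
    case True
    with \<open>x [^] (p - i) = h\<close> hi(1) show ?thesis by simp
  next
    case False
    with hi(2) have "coprime (p - i) (order G)"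
      by (intro coprime_below_smallest_prime_divisor[OF p]) auto
    moreover have "x [^] order G \<in> H"
      using x H by (simp add: pow_order_eq_1 subgroup.one_closed)
    ultimately have "x \<in> H"
      using mem_subgroup_if_coprime_pows[OF H x] \<open>x [^] (p - i) = h\<close> hi(1) by metis
    with \<open>x \<notin> H\<close> show ?thesis ..
  qed
qed

text \<open>
  If a conjugate \<open>c\<close> of \<open>h\<close> by \<open>x\<close> were outside \<open>H\<close>, its powers would represent all cosets, so
  \<open>x = k \<otimes> c [^] i\<close> with \<open>k \<in> H\<close>. But \<open>c [^] i = inv x \<otimes> h [^] i \<otimes> x\<close>, and solving for \<open>x\<close> gives
  \<open>x \<in> H\<close>, hence \<open>c \<in> H\<close> after all.
\<close>
lemma (in group) conj_mem_of_smallest_prime_index: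
  assumes fin: "finite (carrier G)" and p: "smallest_prime_divisor p (order G)"
    and H: "subgroup H G" and index: "p * card H = order G"
    and x: "x \<in> carrier G" and h: "h \<in> H"
  shows "inv x \<otimes> h \<otimes> x \<in> H"
proof (rule ccontr)
  assume c: "inv x \<otimes> h \<otimes> x \<notin> H"
  have hG: "h \<in> carrier G" using H h by (rule subgroup.mem_carrier)
  have pow: "(inv x \<otimes> h \<otimes> x) [^] i = inv x \<otimes> h [^] i \<otimes> x" for i :: nat
  proof (induction i)
    case (Suc i)
    then have "(inv x \<otimes> h \<otimes> x) [^] Suc i = (inv x \<otimes> h [^] i \<otimes> x) \<otimes> (inv x \<otimes> h \<otimes> x)" by simp
    also have "\<dots> = inv x \<otimes> h [^] i \<otimes> (x \<otimes> inv x) \<otimes> h \<otimes> x"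
      using x hG by (simp only: m_assoc m_closed inv_closed nat_pow_closed)
    also have "\<dots> = inv x \<otimes> h [^] Suc i \<otimes> x"
      using x hG by (simp add: m_assoc)
    finally show ?case .
  qed (use x in simp)
  obtain k i where k: "k \<in> H" "x = k \<otimes> (inv x \<otimes> h \<otimes> x) [^] (i::nat)"
    using cosets_of_powers[OF fin p H index _ c x] x hG by (metis inv_closed m_closed)
  have kG: "k \<in> carrier G" using H k(1) by (rule subgroup.mem_carrier)
  have hi: "h [^] i \<in> H" by (rule subgroup_pow_closed[OF H h])
  have "x = (k \<otimes> inv x \<otimes> h [^] i) \<otimes> x"
    using k(2) x hG kG unfolding pow by (simp add: m_assoc)
  then have "k \<otimes> inv x \<otimes> h [^] i = \<one>"
    using x hG kG by (metis l_one m_closed inv_closed nat_pow_closed one_closed right_cancel)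
  then have "k = inv (h [^] i) \<otimes> x"
    using x hG kG by (metis inv_closed inv_equality inv_inv inv_mult_group m_assoc m_closed nat_pow_closed)
  then have "x = h [^] i \<otimes> k" using x hG by (simp add: m_assoc[symmetric])
  then have "x \<in> H" using hi k(1) H by (simp add: subgroup.m_closed)
  with c h H show False by (simp add: subgroup.m_closed subgroup.m_inv_closed)
qed

text \<open>
  The quotient by \<open>H\<close>, which is normal, is generated by the coset of any \<open>x \<notin> H\<close>. Writing
  \<open>y = h \<otimes> x [^] i\<close> turns the commutator into a conjugate of a commutator of \<open>h\<close> and \<open>x\<close>.
\<close>
lemma (in group) commutator_mem_of_smallest_prime_index:
  assumes fin: "finite (carrier G)" and p: "smallest_prime_divisor p (order G)"
    and H: "subgroup H G" and index: "p * card H = order G"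
    and x: "x \<in> carrier G" and y: "y \<in> carrier G"
  shows "inv (y \<otimes> x) \<otimes> (x \<otimes> y) \<in> H"
proof -
  note conj = conj_mem_of_smallest_prime_index[OF fin p H index]
  show ?thesis
  proof (cases "x \<in> H")
    case True
    have "inv (y \<otimes> x) \<otimes> (x \<otimes> y) = inv x \<otimes> (inv y \<otimes> x \<otimes> y)"
      using x y by (simp add: inv_mult_group m_assoc)
    with conj[OF y True] True H show ?thesis
      by (simp add: subgroup.m_closed subgroup.m_inv_closed)
  next
    case False
    obtain h i where h: "h \<in> H" and y_eq: "y = h \<otimes> x [^] (i::nat)"
      using cosets_of_powers[OF fin p H index x False y] by blast
    have hG: "h \<in> carrier G" using H h by (rule subgroup.mem_carrier)
    let ?z = "x [^] Suc i"
    have z: "?z \<in> carrier G" using x by blast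
    have yx: "y \<otimes> x = h \<otimes> ?z" using y_eq hG x by (simp add: m_assoc)
    have xy: "x \<otimes> y = x \<otimes> h \<otimes> inv x \<otimes> ?z"
      using y_eq hG x nat_pow_Suc2[OF x, of i] by (simp del: nat_pow_Suc add: m_assoc inv_solve_left)
    let ?g = "inv h \<otimes> (x \<otimes> h \<otimes> inv x)"
    have "inv (y \<otimes> x) \<otimes> (x \<otimes> y) = inv ?z \<otimes> ?g \<otimes> ?z"
      unfolding yx xy using hG x z by (simp del: nat_pow_Suc add: inv_mult_group m_assoc)
    moreover have "?g \<in> H"
      using conj[of "inv x" h] x h H by (simp add: subgroup.m_closed subgroup.m_inv_closed)
    ultimately show ?thesis using conj[OF z] by simp
  qed
qed


section \<open>Relations whose centralizers are subgroups\<close>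

text \<open>
  Commuting in a group is the model: there \<open>cent\<close> and \<open>center\<close> below are the usual centralizer and
  centre. In a skew brace, with the circle group and the relation \<open>brace_commute\<close>, they are \<open>Cb\<close>
  and \<open>Ann\<close>.
\<close>
locale centralizer_relation = group G for G (structure) +
  fixes R :: "'a \<Rightarrow> 'a \<Rightarrow> bool"
  assumes fin: "finite (carrier G)"
    and R_sym: "\<lbrakk>x \<in> carrier G; y \<in> carrier G; R x y\<rbrakk> \<Longrightarrow> R y x"
    and subgroup_R: "x \<in> carrier G \<Longrightarrow> subgroup {y \<in> carrier G. R x y} G"
begin

definition cent :: "'a \<Rightarrow> 'a set" where
  "cent x = {y \<in> carrier G. R x y}"

definition center :: "'a set" where
  "center = {x \<in> carrier G. cent x = carrier G}"

definition commuting_probability :: real where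
  "commuting_probability =
     real (card {(x, y) \<in> carrier G \<times> carrier G. R x y}) / (real (order G))\<^sup>2"

lemma subgroup_cent: "x \<in> carrier G \<Longrightarrow> subgroup (cent x) G"
  unfolding cent_def by (rule subgroup_R)

lemma cent_subset: "cent x \<subseteq> carrier G"
  by (auto simp: cent_def)

lemma cent_sym: "\<lbrakk>x \<in> carrier G; y \<in> cent x\<rbrakk> \<Longrightarrow> x \<in> cent y"
  using R_sym by (auto simp: cent_def)

lemma center_subset: "center \<subseteq> carrier G"
  by (auto simp: center_def)

lemma center_subset_cent: "x \<in> carrier G \<Longrightarrow> center \<subseteq> cent x"
  using cent_sym by (auto simp: center_def)

lemma center_eq_Inter: "center = (\<Inter>x \<in> carrier G. cent x)"
proof
  show "center \<subseteq> (\<Inter>x \<in> carrier G. cent x)" using center_subset_cent by blast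
  show "(\<Inter>x \<in> carrier G. cent x) \<subseteq> center"
    using cent_sym cent_subset one_closed by (fastforce simp: center_def)
qed

lemma subgroup_center: "subgroup center G"
  unfolding center_eq_Inter using subgroup_cent by (intro subgroups_Inter) auto

lemma finite_sets: "finite (cent x)" "finite center"
  using fin cent_subset center_subset finite_subset by blast+

lemma order_pos: "0 < order G"
  using fin by (simp add: order_gt_0_iff_finite)

lemma card_center_pos: "0 < card center"
  by (rule subgroup.finite_imp_card_positive[OF subgroup_center fin])

lemma pairs_eq:
  "real (card {(x, y) \<in> carrier G \<times> carrier G. R x y})
     = real (card center) * real (order G) + (\<Sum>x \<in> carrier G - center. real (card (cent x)))"
proof -
  have "{(x, y) \<in> carrier G \<times> carrier G. R x y} = Sigma (carrier G) cent"
    by (auto simp: cent_def)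
  then have "real (card {(x, y) \<in> carrier G \<times> carrier G. R x y})
      = (\<Sum>x \<in> carrier G. real (card (cent x)))"
    using fin finite_sets by simp
  also have "\<dots> = (\<Sum>x \<in> carrier G - center. real (card (cent x)))
      + (\<Sum>x \<in> center. real (card (cent x)))"
    using fin center_subset by (intro sum.subset_diff)
  also have "(\<Sum>x \<in> center. real (card (cent x))) = (\<Sum>x \<in> center. real (order G))"
    by (intro sum.cong) (auto simp: center_def order_def)
  finally show ?thesis by simp
qed

lemma noncentral_index:
  assumes p: "smallest_prime_divisor p (order G)" and x: "x \<in> carrier G - center"
  obtains m where "m * card (cent x) = order G" "p \<le> m"
proof -
  let ?m = "card (rcosets (cent x))"
  have m: "?m * card (cent x) = order G"
    using subgroup_cent x by (intro lagrange) auto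
  then have "?m \<noteq> 0" using order_pos by (metis less_irrefl mult_0)
  moreover have "?m \<noteq> 1"
  proof
    assume "?m = 1"
    with m have "cent x = carrier G"
      using fin cent_subset by (intro card_subset_eq) (auto simp: order_def)
    with x show False by (auto simp: center_def)
  qed
  moreover have "?m dvd order G" using m by (metis dvd_triv_left)
  ultimately have "p \<le> ?m" by (intro smallest_prime_divisor_le[OF p])
  with m show thesis using that by blast
qed

lemma card_noncentral: "real (card (carrier G - center)) = real (order G) - real (card center)"
  using card_Diff_subset[OF finite_sets(2) center_subset] card_mono[OF fin center_subset]
  by (simp add: order_def of_nat_diff)

text \<open>
  All upper bounds come from this one: \<open>T\<close> is a set of noncentral elements whose centralizers fall
  short of the maximal size \<open>n / p\<close> by at least \<open>\<delta>\<close>.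
\<close>
lemma commuting_probability_le:
  assumes p: "smallest_prime_divisor p (order G)"
    and T: "T \<subseteq> carrier G - center"
    and gap: "\<And>x. x \<in> T \<Longrightarrow> real (card (cent x)) \<le> real (order G) / real p - \<delta>"
  shows "commuting_probability \<le> 1 / real p
    + real (card center) * (real p - 1) / (real p * real (order G))
    - real (card T) * \<delta> / (real (order G))\<^sup>2"
proof -
  define n z where "n = real (order G)" and "z = real (card center)"
  have "n > 0" using order_pos by (simp add: n_def)
  have "real p > 0" using p prime_gt_0_nat by (auto simp: smallest_prime_divisor_def)
  have bound: "real (card (cent x)) \<le> n / p - (if x \<in> T then \<delta> else 0)"
    if x: "x \<in> carrier G - center" for x
  proof (cases "x \<in> T")
    case False
    obtain m where m: "m * card (cent x) = order G" "p \<le> m"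
      using noncentral_index[OF p x] by blast
    then have "p * card (cent x) \<le> order G" by (metis mult_le_mono1)
    then have "real p * real (card (cent x)) \<le> n"
      unfolding n_def by (metis of_nat_le_iff of_nat_mult)
    with \<open>real p > 0\<close> False show ?thesis by (simp add: field_simps)
  qed (use gap in \<open>simp add: n_def\<close>)
  have "(\<Sum>x \<in> carrier G - center. real (card (cent x)))
      \<le> (\<Sum>x \<in> carrier G - center. n / p - (if x \<in> T then \<delta> else 0))"
    by (intro sum_mono bound)
  also have "\<dots> = (n - z) * (n / p) - real (card T) * \<delta>"
  proof -
    have "(carrier G - center) \<inter> T = T" using T by blast
    then show ?thesis
      using fin card_noncentral
      by (simp add: sum_subtractf sum.If_cases n_def z_def Collect_mem_eq)
  qed
  finally have "commuting_probability \<le> (z * n + ((n - z) * (n / p) - real (card T) * \<delta>)) / n\<^sup>2"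
    unfolding commuting_probability_def pairs_eq n_def z_def
    by (intro divide_right_mono) auto
  also have "\<dots> = 1 / p + z * (real p - 1) / (p * n) - real (card T) * \<delta> / n\<^sup>2"
    using \<open>n > 0\<close> \<open>real p > 0\<close> by (simp add: field_simps power2_eq_square)
  finally show ?thesis by (simp add: n_def z_def)
qed

lemma commuting_probability_le_index:
  assumes p: "smallest_prime_divisor p (order G)" and d: "d * card center = order G"
  shows "commuting_probability \<le> (real p + real d - 1) / (real p * real d)"
proof -
  have "real d > 0" using d order_pos by (cases d) auto
  have "real p > 0" using p prime_gt_0_nat by (auto simp: smallest_prime_divisor_def)
  have n: "real (order G) = real d * real (card center)" by (simp flip: d)
  have "commuting_probability \<le> 1 / p + real (card center) * (real p - 1) / (p * real (order G))"
    using commuting_probability_le[OF p, of "{}" 0] by simp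
  also have "\<dots> = (real p + real d - 1) / (real p * real d)"
    unfolding n using \<open>real d > 0\<close> \<open>real p > 0\<close> card_center_pos
    by (simp add: field_simps)
  finally show ?thesis .
qed

text \<open>
  A noncentral centralizer contains the centre and has index at least \<open>p\<close>, the index of the centre,
  so the two coincide.
\<close>
lemma commuting_probability_index_prime:
  assumes p: "smallest_prime_divisor p (order G)" and d: "p * card center = order G"
  shows "commuting_probability = (2 * real p - 1) / (real p)\<^sup>2"
proof -
  define z where "z = real (card center)"
  have "z > 0" using card_center_pos by (simp add: z_def)
  have p0: "p > 0" using p prime_gt_0_nat by (auto simp: smallest_prime_divisor_def)
  have n: "real (order G) = real p * z" by (simp add: z_def flip: d)
  have "card (cent x) = card center" if x: "x \<in> carrier G - center" for x
  proof (rule antisym)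
    obtain m where m: "m * card (cent x) = order G" "p \<le> m"
      using noncentral_index[OF p x] by blast
    then have "p * card (cent x) \<le> p * card center" unfolding d by (metis mult_le_mono1)
    with p0 show "card (cent x) \<le> card center" by simp
    show "card center \<le> card (cent x)"
      using x center_subset_cent by (intro card_mono finite_sets) auto
  qed
  then have "(\<Sum>x \<in> carrier G - center. real (card (cent x))) = (real p * z - z) * z"
    using card_noncentral n by (simp add: z_def)
  then have "commuting_probability = (z * (real p * z) + (real p * z - z) * z) / (real p * z)\<^sup>2"
    unfolding commuting_probability_def pairs_eq n by (simp add: z_def)
  also have "\<dots> = (2 * real p - 1) / (real p)\<^sup>2"
    using \<open>z > 0\<close> p0 by (simp add: field_simps power2_eq_square)
  finally show ?thesis .
qed

text \<open>
  The index of the centre in a centralizer divides the group order and is not \<open>1\<close>, so it is at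
  least \<open>p\<close>.
\<close>
lemma commuting_probability_ge:
  assumes p: "smallest_prime_divisor p (order G)" and d: "d * card center = order G"
    and proper: "\<And>x. x \<in> carrier G \<Longrightarrow> center \<subset> cent x"
  shows "commuting_probability \<ge> (real p * real d + real d - real p) / (real d)\<^sup>2"
proof -
  define z where "z = real (card center)"
  have "z > 0" using card_center_pos by (simp add: z_def)
  have d0: "real d > 0" using d order_pos by (cases d) auto
  have n: "real (order G) = real d * z" by (simp add: z_def flip: d)
  have ge: "real p * z \<le> real (card (cent x))" if x: "x \<in> carrier G" for x
  proof -
    obtain m where m: "card (cent x) = card center * m"
      using subgroup_card_dvd[OF subgroup_center subgroup_cent[OF x] center_subset_cent[OF x]]
      by (rule dvdE)
    have lt: "card center < card (cent x)"
      using proper[OF x] by (intro psubset_card_mono finite_sets)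
    have "card (cent x) dvd order G"
      using subgroup_cent[OF x] lagrange by (metis dvd_triv_right)
    then have "m dvd order G" using m by (metis dvd_mult_right)
    then have "p \<le> m" using lt m by (intro smallest_prime_divisor_le[OF p]) auto
    then have "p * card center \<le> card (cent x)" using m by (simp add: mult.commute)
    then show ?thesis unfolding z_def by (metis of_nat_le_iff of_nat_mult)
  qed
  have "(real p * real d + real d - real p) / (real d)\<^sup>2
      = (z * (real d * z) + (real d * z - z) * (real p * z)) / (real d * z)\<^sup>2"
    using \<open>z > 0\<close> d0 by (simp add: field_simps power2_eq_square)
  also have "(real d * z - z) * (real p * z) = (\<Sum>x \<in> carrier G - center. real p * z)"
    using card_noncentral n by (simp add: z_def)
  also have "(z * (real d * z) + (\<Sum>x \<in> carrier G - center. real p * z)) / (real d * z)\<^sup>2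
      \<le> (z * (real d * z) + (\<Sum>x \<in> carrier G - center. real (card (cent x)))) / (real d * z)\<^sup>2"
    using ge by (intro divide_right_mono add_left_mono sum_mono) auto
  also have "\<dots> = commuting_probability"
    unfolding commuting_probability_def pairs_eq n by (simp add: z_def)
  finally show ?thesis .
qed

text \<open>
  The centre is too small to contain a Sylow \<open>r\<close>-subgroup, since \<open>r\<close> divides its index. An element
  \<open>b\<close> of such a subgroup has \<open>r\<close>-power order, and \<open>b [^] p\<close> lies in any subgroup of index \<open>p\<close>;
  as \<open>p\<close> is coprime to that order, so does \<open>b\<close>.
\<close>
lemma noncentral_element_in_index_p_centralizers:
  assumes p: "smallest_prime_divisor p (order G)"
    and r: "prime r" "r \<noteq> p" "r dvd d" and d: "d * card center = order G"
  obtains b where "b \<in> carrier G - center"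
    and "\<And>x. \<lbrakk>x \<in> carrier G; p * card (cent x) = order G\<rbrakk> \<Longrightarrow> b \<in> cent x"
proof -
  obtain m where m: "order G = r ^ multiplicity r (order G) * m" "\<not> r dvd m"
  proof (rule multiplicity_decompose')
    show "order G \<noteq> 0" using order_pos by simp
    show "\<not> is_unit r" using r(1) not_prime_unit by blast
  qed
  define a where "a = multiplicity r (order G)"
  obtain P where P: "subgroup P G" "card P = r ^ a"
    using sylow_thm[OF r(1) group_axioms _ fin, of a m] m(1) a_def by blast
  have "\<not> P \<subseteq> center"
  proof
    assume "P \<subseteq> center"
    then have "r ^ a dvd card center"
      using subgroup_card_dvd[OF P(1) subgroup_center] P(2) by simp
    then have "r * r ^ a dvd order G"
      using r(3) unfolding d[symmetric] by (rule mult_dvd_mono[rotated])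
    then have "r ^ a * r dvd r ^ a * m"
      using m(1) by (simp add: a_def mult.commute)
    then have "r dvd m" using r(1) by simp
    with m(2) show False ..
  qed
  then obtain b where b: "b \<in> P" "b \<notin> center" by blast
  have bG: "b \<in> carrier G" using P(1) b(1) by (rule subgroup.mem_carrier)
  have "b [^] (r ^ a) = \<one>"
  proof -
    interpret P: group "G\<lparr>carrier := P\<rparr>"
      using P(1) group_axioms by (rule subgroup.subgroup_is_group)
    have "b [^]\<^bsub>G\<lparr>carrier := P\<rparr>\<^esub> order (G\<lparr>carrier := P\<rparr>) = \<one>"
      using P.pow_order_eq_1[of b] b(1) by simp
    then show ?thesis by (simp add: order_def P(2) flip: nat_pow_consistent)
  qed
  show thesis
  proof (rule that)
    show "b \<in> carrier G - center" using bG b(2) by blast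
  next
    fix x assume x: "x \<in> carrier G" "p * card (cent x) = order G"
    show "b \<in> cent x"
    proof (rule mem_subgroup_if_coprime_pows[OF subgroup_cent[OF x(1)] bG])
      show "b [^] p \<in> cent x"
        by (rule pow_mem_of_smallest_prime_index[OF fin p subgroup_cent[OF x(1)] x(2) bG])
      show "b [^] (r ^ a) \<in> cent x"
        using \<open>b [^] (r ^ a) = \<one>\<close> subgroup_cent[OF x(1)] by (simp add: subgroup.one_closed)
      show "coprime p (r ^ a)"
        using p r(1,2) by (simp add: smallest_prime_divisor_def primes_coprime)
    qed
  qed
qed

text \<open>
  Many elements have small centralizers: every \<open>x\<close> not related to the element \<open>b\<close> of the previous
  lemma has index at least \<open>p + 1\<close>. There are at least \<open>n (p - 1) / p\<close> of them, each with a gap of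
  \<open>n / (p (p + 1))\<close>; since \<open>n \<ge> p r \<ge> p (p + 1)\<close>, the total saving is at least
  \<open>n (p - 1) / p \<ge> n / p\<close>.
\<close>
lemma commuting_probability_le_not_prime_power:
  assumes p: "smallest_prime_divisor p (order G)"
    and r: "prime r" "r \<noteq> p" "r dvd d" and d: "d * card center = order G"
  shows "commuting_probability \<le> 1 / real p
    + (real (card center) * (real p - 1) - 1) / (real p * real (order G))"
proof -
  define n z where "n = real (order G)" and "z = real (card center)"
  have n0: "n > 0" using order_pos by (simp add: n_def)
  have pp: "prime p" "p dvd order G" using p by (auto simp: smallest_prime_divisor_def)
  then have p2: "real p \<ge> 2" using prime_ge_2_nat by auto
  obtain b where b: "b \<in> carrier G - center"
    and b_cent: "\<And>x. \<lbrakk>x \<in> carrier G; p * card (cent x) = order G\<rbrakk> \<Longrightarrow> b \<in> cent x"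
    using noncentral_element_in_index_p_centralizers[OF p r d] by blast
  define T where "T = carrier G - cent b"
  have T: "T \<subseteq> carrier G - center"
    using center_subset_cent b by (auto simp: T_def)
  have gap: "real (card (cent x)) \<le> n / p - n / (real p * (real p + 1))" if "x \<in> T" for x
  proof -
    have x: "x \<in> carrier G - center" "x \<notin> cent b" using that T by (auto simp: T_def)
    obtain m where m: "m * card (cent x) = order G" "p \<le> m"
      using noncentral_index[OF p x(1)] by blast
    have "m \<noteq> p" using b_cent[of x] cent_sym[of x b] x m(1) by blast
    with m(2) have "(p + 1) * card (cent x) \<le> order G"
      unfolding m(1)[symmetric] by (intro mult_le_mono1) simp
    then have le: "(real p + 1) * real (card (cent x)) \<le> n"
      unfolding n_def by (metis of_nat_le_iff of_nat_mult of_nat_add of_nat_1)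
    have "n / P - n / (P * (P + 1)) = n / (P + 1)" if "P \<ge> 2" for P :: real
      using that by (simp add: divide_simps) (simp add: algebra_simps)
    moreover have "real (card (cent x)) \<le> n / (real p + 1)"
      using le p2 by (simp add: field_simps)
    ultimately show ?thesis using p2 by metis
  qed
  have card_T: "real (card T) \<ge> n - n / p"
  proof -
    obtain m where m: "m * card (cent b) = order G" "p \<le> m"
      using noncentral_index[OF p b] by blast
    then have "p * card (cent b) \<le> order G" by (metis mult_le_mono1)
    then have "real p * real (card (cent b)) \<le> n"
      unfolding n_def by (metis of_nat_le_iff of_nat_mult)
    then have "real (card (cent b)) \<le> n / p" using p2 by (simp add: field_simps)
    moreover have "real (card T) = n - real (card (cent b))"
      unfolding T_def n_def order_def
      using card_Diff_subset[OF finite_sets(1) cent_subset, of b]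
        card_mono[OF fin cent_subset, of b] by (simp add: of_nat_diff)
    ultimately show ?thesis by simp
  qed
  have n_ge: "n \<ge> p * (real p + 1)"
  proof -
    have r_dvd: "r dvd order G" using r(3) d by (metis dvd_mult2)
    then have "p + 1 \<le> r" using p r(1,2) by (auto simp: smallest_prime_divisor_def)
    have "p * r dvd order G"
      using pp r_dvd r(1,2) by (intro divides_mult) (auto simp: primes_coprime)
    then have "p * r \<le> order G" using order_pos by (rule dvd_imp_le)
    with \<open>p + 1 \<le> r\<close> have "p * (p + 1) \<le> order G" by (meson le_trans mult_le_mono2)
    then show ?thesis unfolding n_def by (metis of_nat_le_iff of_nat_mult of_nat_add of_nat_1)
  qed
  have "n / p \<le> (n - n / p) * (n / (real p * (real p + 1)))"
  proof -
    have "1 \<le> n / (real p * (real p + 1))" using n_ge p2 by simp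
    then have "1 * 1 \<le> (real p - 1) * (n / (real p * (real p + 1)))"
      using p2 by (intro mult_mono) auto
    then have "n / p * 1 \<le> n / p * ((real p - 1) * (n / (real p * (real p + 1))))"
      using n0 p2 by (intro mult_left_mono) auto
    then show ?thesis using p2 by (simp add: field_simps)
  qed
  also have "\<dots> \<le> real (card T) * (n / (real p * (real p + 1)))"
    using card_T n0 p2 by (intro mult_right_mono) auto
  finally have saving: "n / p \<le> real (card T) * (n / (real p * (real p + 1)))" .
  have "commuting_probability \<le> 1 / p + z * (real p - 1) / (p * n)
      - real (card T) * (n / (real p * (real p + 1))) / n\<^sup>2"
    unfolding n_def z_def
    by (intro commuting_probability_le[OF p T]) (use gap in \<open>simp add: n_def\<close>)
  also have "\<dots> \<le> 1 / p + z * (real p - 1) / (p * n) - n / p / n\<^sup>2"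
    using saving by (intro diff_left_mono divide_right_mono) auto
  also have "\<dots> = 1 / p + (z * (real p - 1) - 1) / (p * n)"
    using n0 p2 by (simp add: field_simps power2_eq_square)
  finally show ?thesis by (simp add: n_def z_def)
qed

text \<open>
  Commutators and \<open>p\<close>-th powers lie in every centralizer of index \<open>p\<close>, hence here in all
  centralizers, whose intersection is the centre.
\<close>
lemma elementary_abelian_if_all_index_p:
  assumes p: "smallest_prime_divisor p (order G)" and triv: "center = {\<one>}"
    and all: "\<And>x. x \<in> carrier G - center \<Longrightarrow> p * card (cent x) = order G"
  shows "elementary_abelian G"
proof -
  have mem: "y = \<one>" if "\<And>x. x \<in> carrier G - center \<Longrightarrow> y \<in> cent x" "y \<in> carrier G" for y
  proof -
    have "y \<in> center"
      unfolding center_eq_Inter using that by (auto simp: center_def)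
    then show ?thesis using triv by simp
  qed
  have "x \<otimes> y = y \<otimes> x" if xy: "x \<in> carrier G" "y \<in> carrier G" for x y
  proof -
    have "inv (y \<otimes> x) \<otimes> (x \<otimes> y) = \<one>"
    proof (rule mem)
      fix u assume u: "u \<in> carrier G - center"
      then show "inv (y \<otimes> x) \<otimes> (x \<otimes> y) \<in> cent u"
        using commutator_mem_of_smallest_prime_index[OF fin p subgroup_cent all[OF u] xy] by blast
    qed (use xy in auto)
    then show ?thesis using xy by (metis inv_closed inv_equality inv_inv inv_unique m_closed r_inv)
  qed
  then have "comm_group G" by unfold_locales
  moreover have "x [^] p = \<one>" if x: "x \<in> carrier G" for x
  proof (rule mem)
    fix u assume u: "u \<in> carrier G - center"
    then show "x [^] p \<in> cent u"
      using pow_mem_of_smallest_prime_index[OF fin p subgroup_cent all[OF u] x] by blast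
  qed (use x in auto)
  ultimately show ?thesis
    using p by (auto simp: elementary_abelian_def smallest_prime_divisor_def)
qed

text \<open>
  Some noncentral centralizer has index other than \<open>p\<close>; in a \<open>p\<close>-group that index is at least
  \<open>p\<^sup>2\<close>, and this single element accounts for the improvement over the general bound.
\<close>
lemma commuting_probability_le_not_elementary_abelian:
  assumes p: "smallest_prime_divisor p (order G)" and n: "order G = p ^ n"
    and triv: "card center = 1" and not_elem: "\<not> elementary_abelian G"
  shows "commuting_probability \<le> 1 / real p + (real p - 1)\<^sup>2 / (real p) ^ (n + 2)"
proof -
  have "prime p" using p by (simp add: smallest_prime_divisor_def)
  then have p2: "real p \<ge> 2" using prime_ge_2_nat by auto
  have "center = {\<one>}"
    using triv subgroup.one_closed[OF subgroup_center] by (auto simp: card_1_singleton_iff)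
  then obtain x where x: "x \<in> carrier G - center" "p * card (cent x) \<noteq> order G"
    using elementary_abelian_if_all_index_p[OF p] not_elem by blast
  obtain m where m: "m * card (cent x) = order G" "p \<le> m"
    using noncentral_index[OF p x(1)] by blast
  then have "m dvd p ^ n" using n by (metis dvd_triv_left)
  then obtain j where j: "m = p ^ j" using \<open>prime p\<close> by (auto simp: divides_primepow_nat)
  have "j \<noteq> 0" using m(2) j p2 by (cases "j = 0") auto
  moreover have "j \<noteq> 1" using x(2) m(1) j by auto
  ultimately have "2 \<le> j" by linarith
  then have "p\<^sup>2 \<le> m" unfolding j using p2 by (intro power_increasing) auto
  then have "p\<^sup>2 * card (cent x) \<le> order G" using m(1) by (metis mult_le_mono1)
  then have le: "(real p)\<^sup>2 * real (card (cent x)) \<le> real (order G)"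
    by (metis of_nat_le_iff of_nat_mult of_nat_power)
  let ?\<delta> = "real (order G) / p - real (order G) / (real p)\<^sup>2"
  have "commuting_probability \<le> 1 / p + real (card center) * (real p - 1) / (p * real (order G))
      - real (card {x}) * ?\<delta> / (real (order G))\<^sup>2"
  proof (rule commuting_probability_le[OF p])
    show "{x} \<subseteq> carrier G - center" using x(1) by blast
    show "real (card (cent y)) \<le> real (order G) / p - ?\<delta>" if "y \<in> {x}" for y
      using that le p2 by (simp add: field_simps)
  qed
  also have "\<dots> = 1 / real p + (real p - 1)\<^sup>2 / (real p) ^ (n + 2)"
    unfolding triv n using p2 by (simp add: field_simps power2_eq_square power_add)
  finally show ?thesis .
qed

lemma commuting_probability_prime_power:
  assumes p: "smallest_prime_divisor p (order G)" and n: "order G = p ^ n"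
    and d: "d * card center = order G"
  shows "commuting_probability = 1 \<or> commuting_probability = (2 * real p - 1) / (real p)\<^sup>2
    \<or> commuting_probability \<le> ((real p)\<^sup>2 + real p - 1) / (real p) ^ 3"
proof -
  have "prime p" using p by (simp add: smallest_prime_divisor_def)
  then have p2: "real p \<ge> 2" using prime_ge_2_nat by auto
  have "d dvd p ^ n" using n d by (metis dvd_triv_left)
  then obtain j where j: "d = p ^ j" using \<open>prime p\<close> by (auto simp: divides_primepow_nat)
  consider "j = 0" | "j = 1" | "2 \<le> j" by linarith
  then show ?thesis
  proof cases
    case 1
    then have "card center = order G" using d j by simp
    then have "center = carrier G"
      using fin center_subset by (intro card_subset_eq) (auto simp: order_def)
    then have "commuting_probability = 1"
      unfolding commuting_probability_def pairs_eq using order_pos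
      by (simp add: order_def power2_eq_square)
    then show ?thesis ..
  next
    case 2
    then show ?thesis using commuting_probability_index_prime[OF p] d j by simp
  next
    case 3
    have "commuting_probability \<le> (real p + real d - 1) / (real p * real d)"
      by (rule commuting_probability_le_index[OF p d])
    also have "\<dots> = 1 / p + (1 - 1 / p) / d"
      using p2 j by (simp add: field_simps)
    also have "\<dots> \<le> 1 / p + (1 - 1 / p) / (real p)\<^sup>2"
    proof -
      have "(real p)\<^sup>2 \<le> real d" unfolding j using 3 p2 by (simp add: power_increasing)
      then show ?thesis using p2 j by (intro add_left_mono divide_left_mono) auto
    qed
    also have "\<dots> = ((real p)\<^sup>2 + real p - 1) / (real p) ^ 3"
      using p2 by (simp add: field_simps power2_eq_square power3_eq_cube)
    finally show ?thesis by blast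
  qed
qed

end


section \<open>Skew braces\<close>

context skew_left_brace
begin

interpretation additive: group "add_monoid B"
  rewrites "carrier (add_monoid B) = carrier B" and "mult (add_monoid B) = add B"
    and "one (add_monoid B) = zero B" and "m_inv (add_monoid B) = a_inv B"
  by (rule additive_group) (auto simp: a_inv_def fun_eq_iff)

interpretation circle: group B
  by (rule circle_group)

lemma zero_eq_one: "\<zero> = \<one>"
proof -
  have "\<one> \<otimes> (\<zero> \<oplus> \<zero>) = ((\<one> \<otimes> \<zero>) \<ominus> \<one>) \<oplus> (\<one> \<otimes> \<zero>)"
    by (rule brace_law) auto
  then have "\<zero> = \<ominus> \<one>"
    by (simp add: a_minus_def)
  then show ?thesis
    by (metis additive.inv_inv additive.inv_one circle.one_closed)
qed

lemma add_one:
  assumes "x \<in> carrier B"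
  shows "x \<oplus> \<one> = x" "\<one> \<oplus> x = x"
  using additive.r_one[OF assms] additive.l_one[OF assms] unfolding zero_eq_one .

lemma brace_star_eq_one_iff:
  assumes a: "a \<in> carrier B" and b: "b \<in> carrier B"
  shows "brace_star B a b = \<one> \<longleftrightarrow> a \<otimes> b = a \<oplus> b"
proof -
  have "brace_star B a b = \<one> \<longleftrightarrow> \<ominus> a \<oplus> (a \<otimes> b) = b"
    unfolding brace_star_def a_minus_def zero_eq_one[symmetric]
    using a b by (metis additive.inv_closed additive.inv_equality additive.inv_inv additive.m_closed
        additive.r_inv circle.m_closed)
  also have "\<dots> \<longleftrightarrow> a \<otimes> b = a \<oplus> b"
    using a b by (metis additive.inv_closed additive.inv_solve_left circle.m_closed)
  finally show ?thesis .
qed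

lemma add_commutator_eq_one_iff:
  assumes a: "a \<in> carrier B" and b: "b \<in> carrier B"
  shows "add_commutator B a b = \<one> \<longleftrightarrow> a \<oplus> b = b \<oplus> a"
proof -
  have "add_commutator B a b = \<one> \<longleftrightarrow> (a \<oplus> b) \<oplus> \<ominus> a = b"
    unfolding add_commutator_def a_minus_def zero_eq_one[symmetric]
    using a b by (metis additive.inv_closed additive.inv_equality additive.inv_inv additive.m_closed
        additive.r_inv)
  also have "\<dots> \<longleftrightarrow> a \<oplus> b = b \<oplus> a"
    using a b by (metis additive.inv_solve_right' additive.m_closed)
  finally show ?thesis .
qed

lemma brace_commute_iff:
  assumes "a \<in> carrier B" "b \<in> carrier B"
  shows "brace_commute B a b \<longleftrightarrow> a \<otimes> b = a \<oplus> b \<and> b \<otimes> a = b \<oplus> a \<and> a \<oplus> b = b \<oplus> a"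
  using assms brace_star_eq_one_iff add_commutator_eq_one_iff by (simp add: brace_commute_def)

text \<open>
  If \<open>b \<otimes> x\<close> is the sum of \<open>b\<close> and \<open>x\<close> in the right order, the inner \<open>\<ominus> b\<close> of the brace law cancels
  and left multiplication by \<open>b\<close> passes over the summand \<open>x\<close>.
\<close>
lemma circle_add_of_sum:
  assumes "b \<in> carrier B" "x \<in> carrier B" "c \<in> carrier B" and "b \<otimes> x = x \<oplus> b"
  shows "b \<otimes> (x \<oplus> c) = x \<oplus> (b \<otimes> c)"
  using assms by (simp add: brace_law a_minus_def additive.m_assoc)

lemma circle_sum_add:
  assumes "b \<in> carrier B" "x \<in> carrier B" "c \<in> carrier B" and "b \<otimes> x = b \<oplus> x"
  shows "b \<otimes> (c \<oplus> x) = (b \<otimes> c) \<oplus> x"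
  using assms by (simp add: brace_law a_minus_def additive.m_assoc[symmetric])
    (simp add: additive.m_assoc)

text \<open>
  For closure, compute \<open>b \<otimes> c \<otimes> x\<close>. As \<open>c \<otimes> x\<close> equals both \<open>x \<oplus> c\<close> and \<open>c \<oplus> x\<close>, it equals
  both \<open>x \<oplus> (b \<otimes> c)\<close> and \<open>(b \<otimes> c) \<oplus> x\<close> by the two preceding lemmas. For inverses, the same lemmas
  show that \<open>b\<close> maps both \<open>x \<oplus> inv b\<close> and \<open>inv b \<oplus> x\<close> to \<open>x\<close>.
\<close>
lemma subgroup_Cb:
  assumes x: "x \<in> carrier B"
  shows "subgroup {y \<in> carrier B. brace_commute B x y} B"
proof (rule circle.subgroupI)
  show "{y \<in> carrier B. brace_commute B x y} \<subseteq> carrier B" by blast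
  have "brace_commute B x \<one>"
    using x by (simp add: brace_commute_iff add_one)
  then show "{y \<in> carrier B. brace_commute B x y} \<noteq> {}" by auto
next
  fix b c
  assume "b \<in> {y \<in> carrier B. brace_commute B x y}" and "c \<in> {y \<in> carrier B. brace_commute B x y}"
  then have b: "b \<in> carrier B" and c: "c \<in> carrier B"
    and bx: "x \<otimes> b = x \<oplus> b" "b \<otimes> x = x \<oplus> b" "b \<oplus> x = x \<oplus> b"
    and cx: "x \<otimes> c = x \<oplus> c" "c \<otimes> x = x \<oplus> c" "c \<oplus> x = x \<oplus> c"
    using x by (auto simp: brace_commute_iff)
  have "b \<otimes> (x \<oplus> c) = x \<oplus> (b \<otimes> c)"
    using b x c bx by (intro circle_add_of_sum) auto
  moreover have "b \<otimes> (c \<oplus> x) = (b \<otimes> c) \<oplus> x"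
    using b x c bx by (intro circle_sum_add) auto
  moreover have "(b \<otimes> c) \<otimes> x = b \<otimes> (x \<oplus> c)"
    using b c x cx by (simp add: circle.m_assoc)
  moreover have "x \<otimes> (b \<otimes> c) = b \<otimes> (x \<oplus> c)"
    using b c x bx cx by (metis circle.m_assoc)
  ultimately show "b \<otimes> c \<in> {y \<in> carrier B. brace_commute B x y}"
    using b c x cx by (simp add: brace_commute_iff)
next
  fix b
  assume "b \<in> {y \<in> carrier B. brace_commute B x y}"
  then have b: "b \<in> carrier B"
    and bx: "x \<otimes> b = x \<oplus> b" "b \<otimes> x = x \<oplus> b" "b \<oplus> x = x \<oplus> b"
    using x by (auto simp: brace_commute_iff)
  let ?b = "inv b"
  have "b \<otimes> (x \<oplus> ?b) = x"
    using b x bx circle_add_of_sum[of b x ?b] by (simp add: add_one)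
  then have 1: "x \<oplus> ?b = ?b \<otimes> x"
    using b x by (metis additive.m_closed circle.inv_closed circle.inv_solve_left')
  have "b \<otimes> (?b \<oplus> x) = x"
    using b x bx circle_sum_add[of b x ?b] by (simp add: add_one)
  then have 2: "?b \<oplus> x = ?b \<otimes> x"
    using b x by (metis additive.m_closed circle.inv_closed circle.inv_solve_left')
  have "x \<otimes> ?b = ?b \<otimes> x"
    using b x bx by (metis circle.inv_closed circle.inv_solve_left circle.inv_solve_right circle.m_assoc circle.m_closed)
  with 1 2 show "?b \<in> {y \<in> carrier B. brace_commute B x y}"
    using b x by (simp add: brace_commute_iff)
qed

lemma centralizer_relation_brace_commute:
  assumes "finite (carrier B)"
  shows "centralizer_relation B (brace_commute B)"
proof (intro centralizer_relation.intro centralizer_relation_axioms.intro)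
  show "group B" by (rule circle_group)
  show "finite (carrier B)" by fact
  show "brace_commute B y x"
    if "x \<in> carrier B" "y \<in> carrier B" "brace_commute B x y" for x y
    using that by (simp add: brace_commute_iff)
qed (rule subgroup_Cb)

lemma cent_eq_Cb:
  assumes "finite (carrier B)"
  shows "centralizer_relation.cent B (brace_commute B) x = Cb B x"
  using centralizer_relation.cent_def[OF centralizer_relation_brace_commute[OF assms]]
  by (simp add: Cb_def)

lemma Ann_iff: "a \<in> Ann B \<longleftrightarrow> a \<in> carrier B \<and> Cb B a = carrier B"
proof -
  have "Cb B a = carrier B \<longleftrightarrow> (\<forall>b \<in> carrier B. brace_commute B a b)"
    by (auto simp: Cb_def)
  moreover have "brace_commute B a b \<longleftrightarrow> a \<oplus> b = b \<oplus> a \<and> b \<oplus> a = a \<otimes> b \<and> a \<otimes> b = b \<otimes> a"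
    if "a \<in> carrier B" "b \<in> carrier B" for b
    unfolding brace_commute_iff[OF that] by metis
  ultimately show ?thesis unfolding Ann_def by blast
qed

lemma center_eq_Ann:
  assumes "finite (carrier B)"
  shows "centralizer_relation.center B (brace_commute B) = Ann B"
  unfolding centralizer_relation.center_def[OF centralizer_relation_brace_commute[OF assms]]
    cent_eq_Cb[OF assms]
  using Ann_iff by blast

text \<open>
  The order of the quotient counts additive cosets, so Lagrange's theorem is needed for the
  additive group. On the annihilator the two operations agree, and so do the two inverses.
\<close>
lemma subgroup_Ann_additive:
  assumes fin: "finite (carrier B)"
  shows "subgroup (Ann B) (add_monoid B)"
proof -
  interpret A: subgroup "Ann B" B
    using centralizer_relation.subgroup_center[OF centralizer_relation_brace_commute[OF fin]]
    by (simp add: center_eq_Ann[OF fin])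
  have add: "a \<oplus> b = a \<otimes> b" if "a \<in> Ann B" "b \<in> carrier B" for a b
  proof -
    have "a \<oplus> b = b \<oplus> a" "b \<oplus> a = a \<otimes> b" using that unfolding Ann_def by blast+
    then show ?thesis by (rule trans)
  qed
  show ?thesis
  proof (rule group.subgroupI[OF additive_group])
    show "Ann B \<subseteq> carrier (add_monoid B)" using A.subset by simp
    show "Ann B \<noteq> {}" using A.one_closed by blast
  next
    fix a assume a: "a \<in> Ann B"
    then have "inv a \<oplus> a = \<zero>"
      using add[of "inv a" a] by (simp add: zero_eq_one circle.l_inv)
    then have "\<ominus> a = inv a"
      using a by (intro additive.inv_equality) auto
    then show "inv\<^bsub>add_monoid B\<^esub> a \<in> Ann B"
      using a by (simp flip: a_inv_def)
  next
    fix a b assume "a \<in> Ann B" "b \<in> Ann B"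
    then show "a \<otimes>\<^bsub>add_monoid B\<^esub> b \<in> Ann B" using add by simp
  qed
qed

lemma order_Ann_quotient:
  assumes "finite (carrier B)"
  shows "order (Ann_quotient B) * card (Ann B) = order B"
  using group.lagrange[OF additive_group subgroup_Ann_additive[OF assms]]
  by (simp add: FactRing_def A_RCOSETS_def order_def)

end

lemma prime_divisor_ne_of_not_prime_power:
  assumes "\<not> prime_power_order G" "order G \<noteq> 0" "prime p"
  obtains r where "prime r" "r \<noteq> p" "r dvd order G"
proof -
  obtain m where m: "order G = p ^ multiplicity p (order G) * m" "\<not> p dvd m"
  proof (rule multiplicity_decompose')
    show "order G \<noteq> 0" by fact
    show "\<not> is_unit p" using assms(3) not_prime_unit by blast
  qed
  have "m \<noteq> 1" using m(1) assms(1,3) by (metis mult.right_neutral prime_power_order_def)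
  then obtain r where "prime r" "r dvd m" using prime_factor_nat by blast
  with m show thesis using that by (metis dvd_mult)
qed

theorem proposition3p4:
  fixes B :: "('a, 'm) ring_scheme" and p d :: nat
  assumes "skew_left_brace B"
    and "finite (carrier B)"
    and "smallest_prime_divisor p (order B)"
    and "d = order (Ann_quotient B)"
  shows
    "(order (Ann_quotient B) = p \<longrightarrow> Pb B = (2 * real p - 1) / (real p)\<^sup>2)
   \<and> (Pb B \<le> (real p + real d - 1) / (real p * real d)
      \<and> (Ann B \<noteq> carrier B \<longrightarrow>
           (real p + real d - 1) / (real p * real d) \<le> (2 * real p - 1) / (real p)\<^sup>2)
      \<and> ((\<forall>x \<in> carrier B. Ann B \<subset> Cb B x) \<longrightarrow>
           Pb B \<ge> (real p * real d + real d - real p) / (real d)\<^sup>2))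
   \<and> (\<forall>q s :: nat. \<not> prime_power_order (Ann_quotient B)
        \<and> second_smallest_prime_divisor q (order B) \<and> (s = q \<or> s = p\<^sup>2) \<longrightarrow>
        Pb B \<le> 1 / real p
          + (real (card (Ann B)) * (real p - 1) - 1) / (real p * real (order B))
          + 1 / (real s * real (order B)))
   \<and> (\<forall>n :: nat. order B = p ^ n \<longrightarrow>
        Pb B = 1 \<or> Pb B = (2 * real p - 1) / (real p)\<^sup>2
        \<or> Pb B \<le> ((real p)\<^sup>2 + real p - 1) / (real p) ^ 3)
   \<and> (\<forall>n :: nat. order B = p ^ n \<and> card (Ann B) = 1 \<and> \<not> elementary_abelian B \<longrightarrow>
        Pb B \<le> 1 / real p + (real p - 1)\<^sup>2 / (real p) ^ (n + 2))"
proof -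
  interpret skew_left_brace B by fact
  interpret C: centralizer_relation B "brace_commute B"
    by (rule centralizer_relation_brace_commute) fact
  note p = assms(3)
  have Z: "C.center = Ann B" and cent: "\<And>x. C.cent x = Cb B x"
    using assms(2) by (rule center_eq_Ann, rule cent_eq_Cb)
  have Pb: "Pb B = C.commuting_probability"
    by (simp add: Pb_def C.commuting_probability_def)
  have d: "d * card C.center = order B"
    unfolding Z assms(4) by (rule order_Ann_quotient) fact
  have "prime p" using p by (simp add: smallest_prime_divisor_def)
  then have p2: "real p \<ge> 2" using prime_ge_2_nat by auto
  have d0: "d \<noteq> 0" using d C.order_pos by (metis less_irrefl mult_0)
  have d_le: "(real p + real d - 1) / (real p * real d) \<le> (2 * real p - 1) / (real p)\<^sup>2"
    if "Ann B \<noteq> carrier B"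
  proof -
    have "d \<noteq> 1"
    proof
      assume "d = 1"
      with d have "C.center = carrier B"
        using assms(2) C.center_subset by (intro card_subset_eq) (auto simp: order_def)
      with that Z show False by simp
    qed
    moreover note d0
    moreover have "d dvd order B" using d by (metis dvd_triv_left)
    ultimately have "p \<le> d" by (intro smallest_prime_divisor_le[OF p])
    then have "real p \<le> real d" by simp
    have "(real p + real d - 1) / (real p * real d) = 1 / p + (1 - 1 / p) / d"
      using p2 \<open>real p \<le> real d\<close> by (simp add: field_simps)
    also have "\<dots> \<le> 1 / p + (1 - 1 / p) / p"
      using p2 \<open>real p \<le> real d\<close> by (intro add_left_mono divide_left_mono) auto
    also have "\<dots> = (2 * real p - 1) / (real p)\<^sup>2"
      using p2 by (simp add: field_simps power2_eq_square)
    finally show ?thesis .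
  qed
  have not_prime_power: "Pb B \<le> 1 / real p
      + (real (card (Ann B)) * (real p - 1) - 1) / (real p * real (order B))
      + 1 / (real s * real (order B))"
    if npp: "\<not> prime_power_order (Ann_quotient B)" for s :: nat
  proof -
    obtain r where r: "prime r" "r \<noteq> p" "r dvd d"
      using prime_divisor_ne_of_not_prime_power[OF npp _ \<open>prime p\<close>] d0 assms(4) by blast
    have "Pb B \<le> 1 / real p
        + (real (card (Ann B)) * (real p - 1) - 1) / (real p * real (order B))"
      using C.commuting_probability_le_not_prime_power[OF p r d] by (simp add: Pb Z)
    moreover have "0 \<le> 1 / (real s * real (order B))" by simp
    ultimately show ?thesis by linarith
  qed
  show ?thesis
  proof (intro conjI allI impI)
    assume "order (Ann_quotient B) = p"
    then show "Pb B = (2 * real p - 1) / (real p)\<^sup>2"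
      unfolding Pb using C.commuting_probability_index_prime[OF p] d assms(4) by simp
  next
    show "Pb B \<le> (real p + real d - 1) / (real p * real d)"
      unfolding Pb by (rule C.commuting_probability_le_index[OF p d])
  next
    assume "\<forall>x \<in> carrier B. Ann B \<subset> Cb B x"
    then show "(real p * real d + real d - real p) / (real d)\<^sup>2 \<le> Pb B"
      unfolding Pb by (intro C.commuting_probability_ge[OF p d]) (simp add: Z cent)
  next
    fix n assume "order B = p ^ n"
    then show "Pb B = 1 \<or> Pb B = (2 * real p - 1) / (real p)\<^sup>2
        \<or> Pb B \<le> ((real p)\<^sup>2 + real p - 1) / (real p) ^ 3"
      unfolding Pb by (rule C.commuting_probability_prime_power[OF p _ d])
  next
    fix n assume "order B = p ^ n \<and> card (Ann B) = 1 \<and> \<not> elementary_abelian B"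
    then show "Pb B \<le> 1 / real p + (real p - 1)\<^sup>2 / (real p) ^ (n + 2)"
      unfolding Pb
      by (intro C.commuting_probability_le_not_elementary_abelian[OF p]) (auto simp: Z)
  qed (use d_le not_prime_power in auto)
qed

end
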